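(* Let $\varphi=(\sqrt5+1)/2$ be the golden mean. Then $${}^*\mathbb Z^{\rm sym}(\varphi)=\{n\in{}^*\mathbb Z(\varphi):\ \text{Z-deg}(n)<\infty\},$$ where $\text{Z-deg}(n)<\infty$ means $\text{Z-deg}(n)\in\mathbb N\subset{}^*\mathbb N$.
   Context: Fix a nonprincipal ultrafilter $\mathfrak u$ on $\mathbb N$, and let ${}^*\mathbb N\subset{}^*\mathbb Z\subset{}^*\mathbb R$ be the ultrapowers of $\mathbb N\subset\mathbb Z\subset\mathbb R$, and ${}^*\mathbb R_\varepsilon$ the infinitesimals of ${}^*\mathbb R$. For $\theta\in\mathbb R$, ${}^*\mathbb Z(\theta)$ is the group of $n\in{}^*\mathbb Z$ for which there is a (unique) $n^\perp\in{}^*\mathbb Z$ with $\varepsilon(n):=n\theta-n^\perp\in{}^*\mathbb R_\varepsilon$. The set of symmetric diophantine approximations is ${}^*\mathbb Z^{\rm sym}(\theta):=\{0\ne n\in{}^*\mathbb Z(\theta): |n|\cdot|\varepsilon(n)|\text{ is neither infinite nor infinitesimal}\}\cup\{0\}$. Every positive integer $N$ has a unique Zeckendorf representation $N=F_{i_1}+\cdots+F_{i_k}$, where $F_j$ is the $j$-th Fibonacci number ($F_1=F_2=1$) and $2\le i_1<\dots<i_k$ are pairwise nonconsecutive. The Zeckendorf degree is $\text{Z-deg}(N):=i_k-i_1$. For negative $N$ put $\text{Z-deg}(N):=\text{Z-deg}(|N|)$, and $\text{Z-deg}(0):=0$. The map $\text{Z-deg}:\mathbb Z\to\mathbb N$ extends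 coordinatewise to $\text{Z-deg}:{}^*\mathbb Z\to{}^*\mathbb N$. *)

theory Defs
  imports "HOL-Number_Theory.Fib"
begin

subsection \<open>Ultrapowers\<close>

definition nonprincipal_ultrafilter :: "'i filter \<Rightarrow> bool" where
  "nonprincipal_ultrafilter U \<longleftrightarrow>
     U \<noteq> bot \<and>
     (\<forall>P. eventually P U \<or> eventually (\<lambda>i. \<not> P i) U) \<and>
     (\<forall>a. \<not> eventually (\<lambda>i. i = a) U)"

text \<open>
  A HOL type cannot depend on the ultrafilter, so the ultrapower of a type is the set of
  equivalence classes of sequences modulo \<open>U\<close>. The inclusions between the ultrapowers of
  \<^typ>\<open>nat\<close>, \<^typ>\<open>int\<close> and \<^typ>\<open>real\<close> are the extensions of the usual coercions.
\<close>

definition ultra_rel :: "nat filter \<Rightarrow> (nat \<Rightarrow> 'a) rel" where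
  "ultra_rel U = {(x, y). eventually (\<lambda>i. x i = y i) U}"

definition ultrapower :: "nat filter \<Rightarrow> (nat \<Rightarrow> 'a) set set" where
  "ultrapower U = UNIV // ultra_rel U"

definition star_const :: "nat filter \<Rightarrow> 'a \<Rightarrow> (nat \<Rightarrow> 'a) set" where
  "star_const U c = ultra_rel U `` {\<lambda>_. c}"

definition star_map ::
  "nat filter \<Rightarrow> ('a \<Rightarrow> 'b) \<Rightarrow> (nat \<Rightarrow> 'a) set \<Rightarrow> (nat \<Rightarrow> 'b) set" where
  "star_map U f X = (\<Union>x\<in>X. ultra_rel U `` {\<lambda>i. f (x i)})"

definition star_map2 ::
  "nat filter \<Rightarrow> ('a \<Rightarrow> 'b \<Rightarrow> 'c) \<Rightarrow> (nat \<Rightarrow> 'a) set \<Rightarrow> (nat \<Rightarrow> 'b) set \<Rightarrow> (nat \<Rightarrow> 'c) set" where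
  "star_map2 U f X Y = (\<Union>x\<in>X. \<Union>y\<in>Y. ultra_rel U `` {\<lambda>i. f (x i) (y i)})"

definition star_less ::
  "nat filter \<Rightarrow> (nat \<Rightarrow> 'a::ord) set \<Rightarrow> (nat \<Rightarrow> 'a) set \<Rightarrow> bool" where
  "star_less U X Y \<longleftrightarrow> (\<exists>x\<in>X. \<exists>y\<in>Y. eventually (\<lambda>i. x i < y i) U)"

definition infinitesimal :: "nat filter \<Rightarrow> (nat \<Rightarrow> real) set \<Rightarrow> bool" where
  "infinitesimal U X \<longleftrightarrow> (\<forall>r>0. star_less U (star_map U abs X) (star_const U r))"

definition infinitely_large :: "nat filter \<Rightarrow> (nat \<Rightarrow> real) set \<Rightarrow> bool" where
  "infinitely_large U X \<longleftrightarrow> (\<forall>r. star_less U (star_const U r) (star_map U abs X))"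

lemma equiv_ultra_rel: "equiv UNIV (ultra_rel U)"
proof (rule equivI)
  show "refl (ultra_rel U)"
    by (auto simp: refl_on_def ultra_rel_def)
  show "sym (ultra_rel U)"
    by (auto simp: sym_def ultra_rel_def eq_commute)
  show "trans (ultra_rel U)"
    by (auto simp: trans_def ultra_rel_def elim: eventually_elim2)
qed simp

lemma ultra_rel_Image_iff:
  "y \<in> ultra_rel U `` {x} \<longleftrightarrow> eventually (\<lambda>i. x i = y i) U"
  by (simp add: ultra_rel_def)

lemma ultra_class_eq_iff:
  "ultra_rel U `` {x} = ultra_rel U `` {y} \<longleftrightarrow> eventually (\<lambda>i. x i = y i) U"
  using eq_equiv_class_iff[OF equiv_ultra_rel, of x y U] by (simp add: ultra_rel_def)

lemma ultra_class_in_ultrapower [simp]: "ultra_rel U `` {x} \<in> ultrapower U"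
  by (simp add: ultrapower_def quotientI)

lemma ultrapowerE:
  assumes "X \<in> ultrapower U"
  obtains x where "X = ultra_rel U `` {x}"
  using assms by (auto simp: ultrapower_def elim: quotientE)

lemma star_map_class [simp]:
  "star_map U f (ultra_rel U `` {x}) = ultra_rel U `` {\<lambda>i. f (x i)}"
proof -
  have "ultra_rel U `` {\<lambda>i. f (x' i)} = ultra_rel U `` {\<lambda>i. f (x i)}"
    if "x' \<in> ultra_rel U `` {x}" for x'
    using that unfolding ultra_class_eq_iff ultra_rel_Image_iff by (rule eventually_mono) simp
  moreover have "x \<in> ultra_rel U `` {x}" by (simp add: ultra_rel_def)
  ultimately show ?thesis unfolding star_map_def by blast
qed

lemma star_map2_class [simp]:
  "star_map2 U f (ultra_rel U `` {x}) (ultra_rel U `` {y}) = ultra_rel U `` {\<lambda>i. f (x i) (y i)}"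
proof -
  have "ultra_rel U `` {\<lambda>i. f (x' i) (y' i)} = ultra_rel U `` {\<lambda>i. f (x i) (y i)}"
    if "x' \<in> ultra_rel U `` {x}" "y' \<in> ultra_rel U `` {y}" for x' y'
    using that unfolding ultra_class_eq_iff ultra_rel_Image_iff by (rule eventually_elim2) simp
  moreover have "x \<in> ultra_rel U `` {x}" "y \<in> ultra_rel U `` {y}" by (simp_all add: ultra_rel_def)
  ultimately show ?thesis unfolding star_map2_def by blast
qed

lemma star_less_class [simp]:
  "star_less U (ultra_rel U `` {x}) (ultra_rel U `` {y}) \<longleftrightarrow> eventually (\<lambda>i. x i < y i) U"
proof
  assume "star_less U (ultra_rel U `` {x}) (ultra_rel U `` {y})"
  then obtain x' y' where
    "eventually (\<lambda>i. x i = x' i) U" "eventually (\<lambda>i. y i = y' i) U"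
    "eventually (\<lambda>i. x' i < y' i) U"
    unfolding star_less_def Bex_def ultra_rel_Image_iff by blast
  then show "eventually (\<lambda>i. x i < y i) U" by eventually_elim simp
next
  assume "eventually (\<lambda>i. x i < y i) U"
  moreover have "x \<in> ultra_rel U `` {x}" "y \<in> ultra_rel U `` {y}" by (simp_all add: ultra_rel_def)
  ultimately show "star_less U (ultra_rel U `` {x}) (ultra_rel U `` {y})"
    unfolding star_less_def by blast
qed

lemma infinitesimal_class:
  "infinitesimal U (ultra_rel U `` {x}) \<longleftrightarrow> (\<forall>r>0. eventually (\<lambda>i. \<bar>x i\<bar> < r) U)"
  by (simp add: infinitesimal_def star_const_def)

lemma infinitely_large_class:
  "infinitely_large U (ultra_rel U `` {x}) \<longleftrightarrow> (\<forall>r. eventually (\<lambda>i. r < \<bar>x i\<bar>) U)"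
  by (simp add: infinitely_large_def star_const_def)


subsection \<open>Diophantine approximations\<close>

definition star_err ::
  "nat filter \<Rightarrow> real \<Rightarrow> (nat \<Rightarrow> int) set \<Rightarrow> (nat \<Rightarrow> int) set \<Rightarrow> (nat \<Rightarrow> real) set" where
  "star_err U \<theta> n m =
     star_map2 U (-) (star_map2 U (*) (star_map U real_of_int n) (star_const U \<theta>))
       (star_map U real_of_int m)"

definition dioph :: "nat filter \<Rightarrow> real \<Rightarrow> (nat \<Rightarrow> int) set set" where
  "dioph U \<theta> = {n \<in> ultrapower U. \<exists>m\<in>ultrapower U. infinitesimal U (star_err U \<theta> n m)}"

definition dioph_perp :: "nat filter \<Rightarrow> real \<Rightarrow> (nat \<Rightarrow> int) set \<Rightarrow> (nat \<Rightarrow> int) set" where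
  "dioph_perp U \<theta> n = (THE m. m \<in> ultrapower U \<and> infinitesimal U (star_err U \<theta> n m))"

definition dioph_eps :: "nat filter \<Rightarrow> real \<Rightarrow> (nat \<Rightarrow> int) set \<Rightarrow> (nat \<Rightarrow> real) set" where
  "dioph_eps U \<theta> n = star_err U \<theta> n (dioph_perp U \<theta> n)"

definition dioph_sym :: "nat filter \<Rightarrow> real \<Rightarrow> (nat \<Rightarrow> int) set set" where
  "dioph_sym U \<theta> =
     {n \<in> dioph U \<theta>. n \<noteq> star_const U 0 \<and>
        (let p = star_map2 U (*) (star_map U abs (star_map U real_of_int n))
                   (star_map U abs (dioph_eps U \<theta> n))
         in \<not> infinitely_large U p \<and> \<not> infinitesimal U p)}
     \<union> {star_const U 0}"

lemma star_err_class:
  "star_err U \<theta> (ultra_rel U `` {n}) (ultra_rel U `` {m}) =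
     ultra_rel U `` {\<lambda>i. real_of_int (n i) * \<theta> - real_of_int (m i)}"
  by (simp add: star_err_def star_const_def)

lemma dioph_perp_unique:
  assumes "n \<in> dioph U \<theta>"
  shows "\<exists>!m. m \<in> ultrapower U \<and> infinitesimal U (star_err U \<theta> n m)"
proof -
  obtain x where x: "n = ultra_rel U `` {x}"
    using assms by (auto simp: dioph_def elim: ultrapowerE)
  have "a = b" if a: "a \<in> ultrapower U" "infinitesimal U (star_err U \<theta> n a)"
    and b: "b \<in> ultrapower U" "infinitesimal U (star_err U \<theta> n b)" for a b
  proof -
    obtain y z where y: "a = ultra_rel U `` {y}" and z: "b = ultra_rel U `` {z}"
      using a b by (auto elim!: ultrapowerE)
    have "eventually (\<lambda>i. \<bar>real_of_int (x i) * \<theta> - real_of_int (y i)\<bar> < 1/2) U"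
         "eventually (\<lambda>i. \<bar>real_of_int (x i) * \<theta> - real_of_int (z i)\<bar> < 1/2) U"
      using a(2) b(2) unfolding x y z star_err_class infinitesimal_class
      by (auto simp del: less_divide_eq_numeral1)
    then have "eventually (\<lambda>i. y i = z i) U"
      by eventually_elim linarith
    then show ?thesis by (simp add: y z ultra_class_eq_iff)
  qed
  then show ?thesis using assms unfolding dioph_def by blast
qed


subsection \<open>Zeckendorf degree\<close>

definition zeckendorf :: "nat set \<Rightarrow> nat \<Rightarrow> bool" where
  "zeckendorf S N \<longleftrightarrow>
     finite S \<and> (\<forall>i\<in>S. 2 \<le> i) \<and> (\<forall>i\<in>S. Suc i \<notin> S) \<and> (\<Sum>i\<in>S. fib i) = N"

definition zeckendorf_set :: "nat \<Rightarrow> nat set" where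
  "zeckendorf_set N = (THE S. zeckendorf S N)"

definition zdeg :: "int \<Rightarrow> nat" where
  "zdeg N =
     (if N = 0 then 0
      else Max (zeckendorf_set (nat \<bar>N\<bar>)) - Min (zeckendorf_set (nat \<bar>N\<bar>)))"

lemma zeckendorf_bound:
  assumes "zeckendorf S N" "\<forall>i\<in>S. i \<le> m"
  shows "N < fib (Suc m)"
  using assms
proof (induction m arbitrary: S N rule: fib.induct)
  case (3 k)
  show ?case
  proof (cases "Suc (Suc k) \<in> S")
    case True
    let ?T = "S - {Suc (Suc k)}"
    have "Suc k \<notin> S" using 3(3) True by (auto simp: zeckendorf_def)
    then have T: "\<forall>i\<in>?T. i \<le> k" using 3(4) by (auto simp: le_Suc_eq)
    have "zeckendorf ?T (\<Sum>i\<in>?T. fib i)" using 3(3) by (auto simp: zeckendorf_def)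
    from 3(2)[OF this T] have "(\<Sum>i\<in>?T. fib i) < fib (Suc k)" .
    moreover have "N = fib (Suc (Suc k)) + (\<Sum>i\<in>?T. fib i)"
      using 3(3) True by (auto simp: zeckendorf_def sum.remove)
    ultimately show ?thesis by simp
  next
    case False
    then have "\<forall>i\<in>S. i \<le> Suc k" using 3(4) by (auto simp: le_Suc_eq)
    from 3(1)[OF 3(3) this] show ?thesis by simp
  qed
next
  case 1
  then have "S = {}" by (force simp: zeckendorf_def)
  with 1 show ?case by (simp add: zeckendorf_def)
next
  case 2
  then have "S = {}" by (force simp: zeckendorf_def)
  with 2 show ?case by (simp add: zeckendorf_def)
qed

lemma zeckendorf_fib_le:
  assumes "zeckendorf S N" "i \<in> S"
  shows "fib i \<le> N"
  using assms by (auto simp: zeckendorf_def intro: member_le_sum)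

lemma zeckendorf_unique:
  assumes "zeckendorf S N" "zeckendorf T N"
  shows "S = T"
  using assms
proof (induction N arbitrary: S T rule: less_induct)
  case (less N)
  have pos: "0 < fib i" if "i \<in> S \<union> T" for i
    using that less.prems by (intro fib_neq_0_nat) (force simp: zeckendorf_def)
  show ?case
  proof (cases "N = 0")
    case True
    then show ?thesis
      using pos zeckendorf_fib_le[OF less.prems(1)] zeckendorf_fib_le[OF less.prems(2)] by fastforce
  next
    case False
    have fin: "finite S" "finite T" and ne: "S \<noteq> {}" "T \<noteq> {}"
      using less.prems False by (auto simp: zeckendorf_def)
    have aux: "Max A \<le> Max B"
      if A: "zeckendorf A N" "finite A" "A \<noteq> {}" and B: "zeckendorf B N" "finite B" for A B
    proof (rule ccontr)
      assume "\<not> Max A \<le> Max B"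
      then have "fib (Suc (Max B)) \<le> fib (Max A)" by (intro fib_mono) simp
      moreover have "N < fib (Suc (Max B))" using B by (intro zeckendorf_bound[of B]) simp_all
      moreover have "fib (Max A) \<le> N" using A Max_in[of A] by (blast intro: zeckendorf_fib_le)
      ultimately show False by simp
    qed
    then have M: "Max S = Max T"
      using fin ne less.prems by (intro antisym) auto
    let ?m = "Max S"
    have mS: "?m \<in> S" and mT: "?m \<in> T" using Max_in[of S] Max_in[of T] fin ne M by simp_all
    have rem: "zeckendorf (A - {?m}) (N - fib ?m)" if "zeckendorf A N" "?m \<in> A" for A
      using that by (auto simp: zeckendorf_def sum_diff1_nat)
    have "N - fib ?m < N" using pos[of ?m] mS False by simp
    from less.IH[OF this rem[OF less.prems(1) mS] rem[OF less.prems(2) mT]]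
    show ?thesis using mS mT by blast
  qed
qed

lemma zeckendorf_exists: "\<exists>S. zeckendorf S N"
proof (induction N rule: less_induct)
  case (less N)
  show ?case
  proof (cases "N = 0")
    case True
    then show ?thesis by (intro exI[of _ "{}"]) (simp add: zeckendorf_def)
  next
    case False
    have large: "k \<le> fib (Suc k)" for k
    proof (induction k rule: fib.induct)
      case (3 k)
      then show ?case using fib_neq_0_nat[of "Suc k"] by simp
    qed auto
    define m where "m = (GREATEST k. fib (Suc (Suc k)) \<le> N)"
    have bnd: "k \<le> N" if "fib (Suc (Suc k)) \<le> N" for k
      using large[of "Suc k"] that by simp
    have "fib (Suc (Suc 0)) \<le> N" using False by simp
    then have m: "fib (Suc (Suc m)) \<le> N"
      unfolding m_def
      by (rule GreatestI_nat[of "\<lambda>k. fib (Suc (Suc k)) \<le> N" 0 N]) (rule bnd)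
    have m': "N < fib (Suc (Suc (Suc m)))"
    proof (rule ccontr)
      assume "\<not> ?thesis"
      then have "Suc m \<le> m"
        using Greatest_le_nat[of "\<lambda>k. fib (Suc (Suc k)) \<le> N" "Suc m" N] bnd
        unfolding m_def[symmetric] not_less by blast
      then show False by simp
    qed
    let ?r = "N - fib (Suc (Suc m))"
    have r: "?r < fib (Suc m)" using m m' by simp
    have "?r < N" using m fib_neq_0_nat[of "Suc (Suc m)"] by linarith
    from less.IH[OF this] obtain S where S: "zeckendorf S ?r" by blast
    have lt: "i < Suc m" if "i \<in> S" for i
    proof (rule ccontr)
      assume "\<not> i < Suc m"
      then have "fib (Suc m) \<le> fib i" by (intro fib_mono) simp
      with zeckendorf_fib_le[OF S that] r show False by simp
    qed
    have "Suc (Suc m) \<notin> S" "Suc (Suc (Suc m)) \<notin> S" using lt by force+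
    then have "zeckendorf (insert (Suc (Suc m)) S) N"
      using S m by (auto simp: zeckendorf_def dest: lt)
    then show ?thesis by blast
  qed
qed

lemma zeckendorf_set: "zeckendorf (zeckendorf_set N) N"
  unfolding zeckendorf_set_def
  using zeckendorf_exists zeckendorf_unique by (metis theI)

end

theory Submission
  imports Defs
begin

text \<open>
  Let \<open>\<rho> = \<phi> - 1 = 1 / \<phi>\<close>, so that \<open>F\<^sub>i \<phi> - F\<^bsub>i+1\<^esub> = - (-\<rho>)\<^sup>i\<close>. If \<open>N\<close> has Zeckendorf indices \<open>S\<close>
  with least element \<open>m\<close> and greatest element \<open>M\<close>, then \<open>N \<phi>\<close> differs from an integer by
  \<open>\<Sum>\<^bsub>i\<in>S\<^esub> (-\<rho>)\<^sup>i\<close>. Since \<open>S\<close> has no consecutive elements, this sum is dominated by its first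
  term and hence comparable to \<open>\<rho>\<^sup>m\<close>, while \<open>N\<close> is comparable to \<open>\<rho>\<^bsup>-M\<^esup>\<close>. So \<open>|N| |\<epsilon>(N)|\<close> is
  comparable, with absolute constants, to \<open>\<rho>\<close> to the power \<open>- Z-deg(N)\<close>: it is never
  infinitesimal, and it is finite exactly when the Zeckendorf degree is.
\<close>

definition golden_conj :: real ("\<rho>") where
  "\<rho> = (sqrt 5 - 1) / 2"

lemma golden_conj_pos: "0 < \<rho>"
  by (simp add: golden_conj_def)

lemma golden_conj_less_1: "\<rho> < 1"
proof -
  have "sqrt 5 < 3" by (rule real_less_lsqrt) simp_all
  then show ?thesis by (simp add: golden_conj_def)
qed

lemma golden_conj_square: "\<rho>\<^sup>2 = 1 - \<rho>"
  by (simp add: golden_conj_def power2_eq_square field_simps)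

lemma golden_conj_power_Suc_Suc: "\<rho> ^ Suc (Suc k) = \<rho> ^ k - \<rho> ^ Suc k"
proof -
  have "\<rho> ^ Suc (Suc k) = \<rho> ^ k * \<rho>\<^sup>2" by (simp add: power2_eq_square)
  then show ?thesis by (simp add: golden_conj_square algebra_simps)
qed

subsection \<open>Fibonacci numbers and the golden mean\<close>

text \<open>Both sides obey the Fibonacci recurrence, because \<open>- \<rho>\<close> is a root of
  \<open>t\<^sup>2 = t + 1\<close>.\<close>

lemma fib_golden_err: "real (fib i) * (1 + \<rho>) - real (fib (Suc i)) = - ((- \<rho>) ^ i)"
proof (induction i rule: fib.induct)
  case (3 k)
  have "(- \<rho>) ^ Suc (Suc k) = (- \<rho>) ^ k + (- \<rho>) ^ Suc k"
  proof -
    have "(- \<rho>) ^ Suc (Suc k) = (- \<rho>) ^ k * \<rho>\<^sup>2" by (simp add: power2_eq_square)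
    then show ?thesis by (simp add: golden_conj_square algebra_simps)
  qed
  then show ?case using 3 by (simp add: algebra_simps)
qed simp_all

text \<open>As \<open>\<rho> + \<rho>\<^sup>2 = 1\<close>, each normalised value is a convex
  combination of the two before it, so all of them stay between the initial values
  \<open>\<rho>\<close> and \<open>1\<close>.\<close>

lemma fib_golden_bounds:
  "\<rho> \<le> real (fib (Suc i)) * \<rho> ^ i \<and> real (fib (Suc i)) * \<rho> ^ i \<le> 1"
proof (induction i rule: fib.induct)
  case (3 k)
  let ?a = "\<lambda>i. real (fib (Suc i)) * \<rho> ^ i"
  have rec: "?a (Suc (Suc k)) = \<rho> * ?a (Suc k) + \<rho>\<^sup>2 * ?a k"
    by (simp add: power2_eq_square algebra_simps)
  have "\<rho> * \<rho> + \<rho>\<^sup>2 * \<rho> \<le> \<rho> * ?a (Suc k) + \<rho>\<^sup>2 * ?a k"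
    using 3 golden_conj_pos by (intro add_mono mult_left_mono) auto
  moreover have "\<rho> * \<rho> + \<rho>\<^sup>2 * \<rho> = \<rho> * (\<rho> + \<rho>\<^sup>2)" by algebra
  moreover have "\<rho> * ?a (Suc k) + \<rho>\<^sup>2 * ?a k \<le> \<rho> * 1 + \<rho>\<^sup>2 * 1"
    using 3 golden_conj_pos by (intro add_mono mult_left_mono) auto
  ultimately show ?case unfolding rec by (simp add: golden_conj_square)
qed (use golden_conj_pos golden_conj_less_1 in auto)

text \<open>The extremal case is the series over m+1, m+3, ..., whose sum is exactly
  \<open>\<rho> ^ m\<close> because \<open>1 - \<rho>\<^sup>2 = \<rho>\<close>. The induction splits
  off the least index \<open>b\<close>: the others are at least b+2 and contribute at most
  \<open>\<rho> ^ Suc b\<close>.\<close>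

lemma sum_golden_conj_powers_le:
  assumes "finite S" "\<forall>i\<in>S. Suc i \<notin> S" "\<forall>i\<in>S. Suc m \<le> i"
  shows "(\<Sum>i\<in>S. \<rho> ^ i) \<le> \<rho> ^ m"
  using assms
proof (induction S arbitrary: m rule: finite_linorder_min_induct)
  case empty
  then show ?case using golden_conj_pos by simp
next
  case (insert b A)
  obtain c where c: "b = Suc c" "m \<le> c" using insert.prems(2) by (cases b) auto
  have "\<forall>i\<in>A. Suc (Suc b) \<le> i"
    using insert.hyps(2) insert.prems(1) by (metis Suc_leI insertCI order_le_less)
  then have "(\<Sum>i\<in>A. \<rho> ^ i) \<le> \<rho> ^ Suc b" using insert.prems(1) by (intro insert.IH) auto
  moreover have "b \<notin> A" using insert.hyps(2) by blast
  ultimately have "(\<Sum>i\<in>insert b A. \<rho> ^ i) \<le> \<rho> ^ Suc c + \<rho> ^ Suc (Suc c)"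
    using insert.hyps(1) c by simp
  also have "\<dots> = \<rho> ^ c"
    using golden_conj_power_Suc_Suc[of c] by simp
  also have "\<dots> \<le> \<rho> ^ m"
    using c golden_conj_pos golden_conj_less_1 by (intro power_decreasing) auto
  finally show ?case .
qed

subsection \<open>Zeckendorf representations and approximation by the golden mean\<close>

text \<open>All indices after the least one, m, are at least m+2, so their terms add up to at most
  \<open>\<rho> ^ Suc m\<close> in absolute value, which leaves
  \<open>\<rho> ^ m - \<rho> ^ Suc m = \<rho> ^ (m + 2)\<close> of the first term.\<close>

lemma zeckendorf_err_bounds:
  assumes "zeckendorf S N" "S \<noteq> {}"
  shows "\<rho> ^ (Min S + 2) \<le> \<bar>\<Sum>i\<in>S. (- \<rho>) ^ i\<bar>"
    and "\<bar>\<Sum>i\<in>S. (- \<rho>) ^ i\<bar> \<le> \<rho> ^ (Min S - 1)"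
proof -
  have fin: "finite S" and ge2: "\<forall>i\<in>S. 2 \<le> i" and nc: "\<forall>i\<in>S. Suc i \<notin> S"
    using assms by (auto simp: zeckendorf_def)
  let ?m = "Min S" let ?T = "S - {?m}"
  have m: "?m \<in> S" using fin assms(2) by simp
  have abs_sum: "\<bar>\<Sum>i\<in>A. (- \<rho>) ^ i\<bar> \<le> (\<Sum>i\<in>A. \<rho> ^ i)" for A :: "nat set"
    using sum_abs[of "\<lambda>i. (- \<rho>) ^ i" A] golden_conj_pos by (simp add: power_abs)
  have T: "\<forall>i\<in>?T. Suc (Suc ?m) \<le> i"
  proof
    fix i assume i: "i \<in> ?T"
    then have "?m \<le> i" using fin by simp
    moreover have "i \<noteq> Suc ?m" using nc m i by blast
    ultimately show "Suc (Suc ?m) \<le> i" using i by simp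
  qed
  have "\<bar>\<Sum>i\<in>?T. (- \<rho>) ^ i\<bar> \<le> \<rho> ^ Suc ?m"
    using fin nc T by (intro order.trans[OF abs_sum] sum_golden_conj_powers_le) auto
  moreover have "(\<Sum>i\<in>S. (- \<rho>) ^ i) = (- \<rho>) ^ ?m + (\<Sum>i\<in>?T. (- \<rho>) ^ i)"
    using fin m by (rule sum.remove)
  moreover have "\<bar>(- \<rho>) ^ ?m\<bar> = \<rho> ^ ?m"
    using golden_conj_pos by (simp add: power_abs)
  ultimately show "\<rho> ^ (Min S + 2) \<le> \<bar>\<Sum>i\<in>S. (- \<rho>) ^ i\<bar>"
    unfolding add_2_eq_Suc' golden_conj_power_Suc_Suc by linarith
  \<comment> \<open>Indices are at least 2, so the subtraction does not truncate.\<close>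
  have "\<forall>i\<in>S. Suc (?m - 1) \<le> i"
    using fin m ge2 by (metis Min_le One_nat_def Suc_1 Suc_le_D Suc_pred diff_Suc_1 zero_less_Suc)
  then show "\<bar>\<Sum>i\<in>S. (- \<rho>) ^ i\<bar> \<le> \<rho> ^ (?m - 1)"
    using fin nc by (intro order.trans[OF abs_sum] sum_golden_conj_powers_le) auto
qed

text \<open>With M the greatest index, N lies between \<open>fib M\<close> and
  \<open>fib (Suc M)\<close>, and both are comparable to the M-th power of
  \<open>1 / \<rho>\<close>.\<close>

lemma zeckendorf_size_bounds:
  assumes "zeckendorf S N" "S \<noteq> {}"
  shows "\<rho>\<^sup>2 \<le> real N * \<rho> ^ Max S" and "real N * \<rho> ^ Max S \<le> 1"
proof -
  have fin: "finite S" using assms by (simp add: zeckendorf_def)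
  then have M: "Max S \<in> S" using assms(2) by simp
  then have "2 \<le> Max S" using assms(1) by (simp add: zeckendorf_def)
  then obtain k where k: "Max S = Suc k" by (cases "Max S") auto
  have "\<rho>\<^sup>2 \<le> real (fib (Max S)) * \<rho> ^ Max S"
    using mult_right_mono[OF conjunct1[OF fib_golden_bounds[of k]], of \<rho>] golden_conj_pos
    by (simp add: k power2_eq_square mult_ac)
  also have "\<dots> \<le> real N * \<rho> ^ Max S"
    using zeckendorf_fib_le[OF assms(1) M] golden_conj_pos by (intro mult_right_mono) auto
  finally show "\<rho>\<^sup>2 \<le> real N * \<rho> ^ Max S" .
  have "N < fib (Suc (Max S))" using fin by (intro zeckendorf_bound[OF assms(1)]) simp
  then have "real N * \<rho> ^ Max S \<le> real (fib (Suc (Max S))) * \<rho> ^ Max S"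
    using golden_conj_pos by (intro mult_right_mono) auto
  also have "\<dots> \<le> 1" using fib_golden_bounds by blast
  finally show "real N * \<rho> ^ Max S \<le> 1" .
qed

text \<open>Shifting every index by one yields the candidate for the integer close to N times the
  golden mean.\<close>

lemma zeckendorf_golden_err:
  assumes "zeckendorf S N"
  shows "real N * (1 + \<rho>) - real (\<Sum>i\<in>S. fib (Suc i)) = - (\<Sum>i\<in>S. (- \<rho>) ^ i)"
proof -
  have "real N * (1 + \<rho>) - real (\<Sum>i\<in>S. fib (Suc i))
      = (\<Sum>i\<in>S. real (fib i) * (1 + \<rho>) - real (fib (Suc i)))"
    using assms by (auto simp: zeckendorf_def sum_subtractf sum_distrib_right simp del: fib.simps)
  then show ?thesis by (simp only: fib_golden_err sum_negf)
qed

text \<open>Multiplying the size and error bounds gives the constants: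
  \<open>\<rho>\<^sup>2 * \<rho>\<^sup>2\<close> below and \<open>1 * (1 / \<rho>)\<close>
  above.\<close>

lemma zdeg_golden_bounds_nat:
  fixes N :: nat and k :: int
  assumes "N \<noteq> 0" and close: "\<bar>real N * (1 + \<rho>) - real_of_int k\<bar> < 1 - \<rho>"
  defines "p \<equiv> real N * \<bar>real N * (1 + \<rho>) - real_of_int k\<bar> * \<rho> ^ zdeg (int N)"
  shows "\<rho> ^ 4 \<le> p" and "p \<le> 1 / \<rho>"
proof -
  let ?S = "zeckendorf_set N"
  let ?m = "Min ?S" let ?M = "Max ?S" let ?e = "\<bar>\<Sum>i\<in>?S. (- \<rho>) ^ i\<bar>"
  have S: "zeckendorf ?S N" by (rule zeckendorf_set)
  then have ne: "?S \<noteq> {}" using assms(1) by (auto simp: zeckendorf_def)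
  have fin: "finite ?S" and ge2: "2 \<le> ?m"
    using S ne by (auto simp: zeckendorf_def)
  have mM: "?m \<le> ?M" using fin ne by simp
  have "?e \<le> \<rho> ^ (?m - 1)" by (rule zeckendorf_err_bounds[OF S ne])
  also have "\<dots> \<le> \<rho> ^ 1"
    using ge2 golden_conj_pos golden_conj_less_1 by (intro power_decreasing) auto
  \<comment> \<open>This explains the tolerance \<open>1 - \<rho>\<close>: the product is within
    \<open>\<rho>\<close> of the shifted sum and within \<open>1 - \<rho>\<close> of
    \<open>k\<close>, so these two integers coincide.\<close>
  finally have "\<bar>real_of_int (int (\<Sum>i\<in>?S. fib (Suc i)) - k)\<bar> < 1"
    using close zeckendorf_golden_err[OF S] by simp
  then have "k = int (\<Sum>i\<in>?S. fib (Suc i))" by linarith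
  then have err: "\<bar>real N * (1 + \<rho>) - real_of_int k\<bar> = ?e"
    using zeckendorf_golden_err[OF S] by simp
  have deg: "\<rho> ^ ?M = \<rho> ^ zdeg (int N) * \<rho> ^ ?m"
    using assms(1) mM by (simp add: zdeg_def flip: power_add)
  \<comment> \<open>The factor \<open>\<rho> ^ ?m\<close> avoids negative exponents; it is cancelled
    at the end of each estimate.\<close>
  have p: "p * \<rho> ^ ?m = (real N * \<rho> ^ ?M) * ?e"
    unfolding p_def err deg by (simp only: mult_ac)
  have "\<rho> ^ 4 * \<rho> ^ ?m = \<rho>\<^sup>2 * \<rho> ^ (?m + 2)" by (simp add: power_add power2_eq_square eval_nat_numeral)
  also have "\<dots> \<le> (real N * \<rho> ^ ?M) * ?e"
    using zeckendorf_size_bounds[OF S ne] zeckendorf_err_bounds[OF S ne] golden_conj_pos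
    by (intro mult_mono) auto
  finally show "\<rho> ^ 4 \<le> p" using golden_conj_pos by (simp flip: p)
  have "p * \<rho> ^ ?m \<le> 1 * \<rho> ^ (?m - 1)"
    unfolding p
    using zeckendorf_size_bounds[OF S ne] zeckendorf_err_bounds[OF S ne] golden_conj_pos
    by (intro mult_mono) auto
  also have "\<dots> = 1 / \<rho> * \<rho> ^ ?m"
    using ge2 golden_conj_pos by (cases ?m) auto
  finally show "p \<le> 1 / \<rho>" using golden_conj_pos by (simp only: mult_le_cancel_right_pos zero_less_power)
qed

text \<open>Negating \<open>n\<close> and \<open>k\<close> together changes neither the error nor
  the degree, which reduces the claim to positive integers.\<close>

lemma zdeg_golden_bounds:
  fixes n k :: int
  assumes "n \<noteq> 0" and close: "\<bar>real_of_int n * (1 + \<rho>) - real_of_int k\<bar> < 1 - \<rho>"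
  defines "p \<equiv> \<bar>real_of_int n\<bar> * \<bar>real_of_int n * (1 + \<rho>) - real_of_int k\<bar>"
  shows "\<rho> ^ 4 \<le> p * \<rho> ^ zdeg n" and "p * \<rho> ^ zdeg n \<le> 1 / \<rho>"
proof -
  let ?N = "nat \<bar>n\<bar>"
  have "real ?N * (1 + \<rho>) - real_of_int (sgn n * k)
      = real_of_int (sgn n) * (real_of_int n * (1 + \<rho>) - real_of_int k)"
    by (auto simp: sgn_if algebra_simps)
  then have e: "\<bar>real ?N * (1 + \<rho>) - real_of_int (sgn n * k)\<bar>
      = \<bar>real_of_int n * (1 + \<rho>) - real_of_int k\<bar>"
    using assms(1) by (simp add: abs_mult sgn_if)
  have d: "zdeg (int ?N) = zdeg n" by (simp add: zdeg_def)
  have N: "real ?N = \<bar>real_of_int n\<bar>" by simp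
  have "?N \<noteq> 0" using assms(1) by simp
  from zdeg_golden_bounds_nat[OF this, of "sgn n * k"] close
  show "\<rho> ^ 4 \<le> p * \<rho> ^ zdeg n" "p * \<rho> ^ zdeg n \<le> 1 / \<rho>"
    unfolding p_def e d by (simp_all only: N)
qed

subsection \<open>Ultrapowers\<close>

text \<open>Finitely many values are possible, and an ultrafilter selects one of them. Hence a
  bounded element of the ultrapower of the naturals is standard.\<close>

lemma ultrafilter_bounded_nat_const:
  fixes f :: "'i \<Rightarrow> nat"
  assumes U: "\<And>P. eventually P U \<or> eventually (\<lambda>i. \<not> P i) U"
    and "eventually (\<lambda>i. f i \<le> B) U"
  shows "\<exists>c. eventually (\<lambda>i. f i = c) U"
  using assms(2)
proof (induction B)
  case 0
  then show ?case by auto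
next
  case (Suc B)
  show ?case
  proof (cases "eventually (\<lambda>i. f i = Suc B) U")
    case False
    then have "eventually (\<lambda>i. f i \<noteq> Suc B) U" using U by blast
    with Suc.prems have "eventually (\<lambda>i. f i \<le> B) U" by eventually_elim simp
    then show ?thesis by (rule Suc.IH)
  qed blast
qed

lemma ultra_class_standard_iff:
  "ultra_rel U `` {x} \<in> range (star_const U) \<longleftrightarrow>
     (\<exists>c. eventually (\<lambda>i. x i = c) U)"
  by (auto simp: star_const_def ultra_class_eq_iff)

lemma golden_dioph_finite_iff:
  assumes U: "nonprincipal_ultrafilter U"
    and nz: "eventually (\<lambda>i. x i \<noteq> 0) U"
    and inf: "\<forall>r>0. eventually (\<lambda>i. \<bar>real_of_int (x i) * (1 + \<rho>) - real_of_int (y i)\<bar> < r) U"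
  defines "p \<equiv> \<lambda>i. \<bar>real_of_int (x i)\<bar> * \<bar>real_of_int (x i) * (1 + \<rho>) - real_of_int (y i)\<bar>"
  shows "\<not> infinitesimal U (ultra_rel U `` {p})"
    and "\<not> infinitely_large U (ultra_rel U `` {p}) \<longleftrightarrow> (\<exists>c. eventually (\<lambda>i. zdeg (x i) = c) U)"
proof -
  have ultra: "\<And>P. eventually P U \<or> eventually (\<lambda>i. \<not> P i) U" and bot: "U \<noteq> bot"
    using U by (auto simp: nonprincipal_ultrafilter_def)
  have p0: "0 \<le> p i" for i by (simp add: p_def)
  have "eventually (\<lambda>i. \<bar>real_of_int (x i) * (1 + \<rho>) - real_of_int (y i)\<bar> < 1 - \<rho>) U"
    using inf golden_conj_less_1 by simp
  with nz have bounds: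
    "eventually (\<lambda>i. \<rho> ^ 4 \<le> p i * \<rho> ^ zdeg (x i) \<and> p i * \<rho> ^ zdeg (x i) \<le> 1 / \<rho>) U"
    unfolding p_def by eventually_elim (intro conjI zdeg_golden_bounds)
  show "\<not> infinitesimal U (ultra_rel U `` {p})"
  proof
    assume "infinitesimal U (ultra_rel U `` {p})"
    then have "eventually (\<lambda>i. \<bar>p i\<bar> < \<rho> ^ 4) U"
      using golden_conj_pos by (simp add: infinitesimal_class)
    with bounds have "eventually (\<lambda>i. False) U"
    proof eventually_elim
      case (elim i)
      \<comment> \<open>The degree is nonnegative, so \<open>\<rho> ^ 4\<close> already bounds
        \<open>p i\<close> from below.\<close>
      have "p i * \<rho> ^ zdeg (x i) \<le> p i * 1"
        using p0 golden_conj_pos golden_conj_less_1 by (intro mult_left_mono power_le_one) auto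
      with elim p0[of i] show False by auto
    qed
    then show False using bot by (simp add: eventually_False)
  qed
  show "\<not> infinitely_large U (ultra_rel U `` {p}) \<longleftrightarrow> (\<exists>c. eventually (\<lambda>i. zdeg (x i) = c) U)"
  proof
    assume "\<not> infinitely_large U (ultra_rel U `` {p})"
    then obtain r where "\<not> eventually (\<lambda>i. r < \<bar>p i\<bar>) U"
      by (auto simp: infinitely_large_class)
    then have le: "eventually (\<lambda>i. \<not> r < \<bar>p i\<bar>) U" using ultra by blast
    \<comment> \<open>\<open>B\<close> is chosen so that a degree above it, together with
      \<open>p i \<le> r\<close>, would violate the lower bound \<open>\<rho> ^ 4\<close>. Since
      \<open>r\<close> may be nonpositive, \<open>\<bar>r\<bar> + 1\<close> serves as
      divisor.\<close>
    have "0 < \<rho> ^ 4 / (\<bar>r\<bar> + 1)"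
      using golden_conj_pos by (intro divide_pos_pos zero_less_power) auto
    then obtain B where B: "\<rho> ^ B < \<rho> ^ 4 / (\<bar>r\<bar> + 1)"
      using real_arch_pow_inv[OF _ golden_conj_less_1] by blast
    from bounds le have "eventually (\<lambda>i. zdeg (x i) \<le> B) U"
    proof eventually_elim
      case (elim i)
      show "zdeg (x i) \<le> B"
      proof (rule ccontr)
        assume "\<not> ?thesis"
        then have "\<rho> ^ zdeg (x i) \<le> \<rho> ^ B"
          using golden_conj_pos golden_conj_less_1 by (intro power_decreasing) auto
        then have "p i * \<rho> ^ zdeg (x i) \<le> (\<bar>r\<bar> + 1) * \<rho> ^ B"
          using elim p0[of i] golden_conj_pos by (intro mult_mono) auto
        also have "\<dots> < \<rho> ^ 4" using B by (simp add: field_simps)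
        finally show False using elim by simp
      qed
    qed
    then show "\<exists>c. eventually (\<lambda>i. zdeg (x i) = c) U"
      by (rule ultrafilter_bounded_nat_const[OF ultra])
  next
    assume "\<exists>c. eventually (\<lambda>i. zdeg (x i) = c) U"
    then obtain c where c: "eventually (\<lambda>i. zdeg (x i) = c) U" ..
    show "\<not> infinitely_large U (ultra_rel U `` {p})"
    proof
      assume "infinitely_large U (ultra_rel U `` {p})"
      \<comment> \<open>This threshold is the upper bound that \<open>bounds\<close> puts on
        \<open>p i\<close> when the degree is \<open>c\<close>.\<close>
      then have "eventually (\<lambda>i. 1 / \<rho> / \<rho> ^ c < \<bar>p i\<bar>) U"
        by (simp add: infinitely_large_class)
      with bounds c have "eventually (\<lambda>i. False) U"
      proof eventually_elim
        case (elim i)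
        then have "p i \<le> 1 / \<rho> / \<rho> ^ c"
          using golden_conj_pos by (subst pos_le_divide_eq) auto
        with elim p0[of i] show False by simp
      qed
      then show False using bot by (simp add: eventually_False)
    qed
  qed
qed

theorem theorem18:
  fixes U :: "nat filter" and \<phi> :: real
  assumes "nonprincipal_ultrafilter U"
    and "\<phi> = (sqrt 5 + 1) / 2"
  shows "dioph_sym U \<phi> =
    {n \<in> dioph U \<phi>. star_map U zdeg n \<in> range (star_const U)}"
proof -
  have phi: "\<phi> = 1 + \<rho>" by (simp add: assms(2) golden_conj_def field_simps)
  have ultra: "\<And>P. eventually P U \<or> eventually (\<lambda>i. \<not> P i) U"
    using assms(1) by (simp add: nonprincipal_ultrafilter_def)
  \<comment> \<open>Zero is adjoined separately in \<open>dioph_sym\<close>, so its membership in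
    the right-hand side needs its own check.\<close>
  have zero: "star_const U 0 \<in> dioph U \<phi>"
    unfolding dioph_def star_const_def
    by (auto simp: star_err_class infinitesimal_class intro!: bexI[of _ "ultra_rel U `` {\<lambda>_. 0}"])
  have zero': "star_map U zdeg (star_const U 0) \<in> range (star_const U)"
    by (simp add: star_const_def ultra_class_standard_iff)
  have iff: "(let p = star_map2 U (*) (star_map U abs (star_map U real_of_int n))
                   (star_map U abs (dioph_eps U \<phi> n))
         in \<not> infinitely_large U p \<and> \<not> infinitesimal U p)
      \<longleftrightarrow> star_map U zdeg n \<in> range (star_const U)"
    if n: "n \<in> dioph U \<phi>" "n \<noteq> star_const U 0" for n
  proof -
    have perp: "dioph_perp U \<phi> n \<in> ultrapower U"
      "infinitesimal U (star_err U \<phi> n (dioph_perp U \<phi> n))"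
      using theI'[OF dioph_perp_unique[OF n(1)]] by (simp_all add: dioph_perp_def)
    obtain x where x: "n = ultra_rel U `` {x}" using n by (auto simp: dioph_def elim: ultrapowerE)
    obtain y where y: "dioph_perp U \<phi> n = ultra_rel U `` {y}" using perp by (auto elim: ultrapowerE)
    \<comment> \<open>Being different from zero as a class means being nonzero almost everywhere, by
      the ultrafilter dichotomy.\<close>
    have nz: "eventually (\<lambda>i. x i \<noteq> 0) U"
      using n(2) ultra unfolding x star_const_def ultra_class_eq_iff by blast
    have inf: "\<forall>r>0. eventually (\<lambda>i. \<bar>real_of_int (x i) * (1 + \<rho>) - real_of_int (y i)\<bar> < r) U"
      using perp(2) unfolding y by (simp add: x phi star_err_class infinitesimal_class)
    have eps: "dioph_eps U \<phi> n
        = ultra_rel U `` {\<lambda>i. real_of_int (x i) * (1 + \<rho>) - real_of_int (y i)}"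
      unfolding dioph_eps_def y by (simp add: x star_err_class phi)
    show ?thesis
      unfolding eps Let_def
      using golden_dioph_finite_iff[OF assms(1) nz inf]
      by (simp add: x ultra_class_standard_iff)
  qed
  show ?thesis
    unfolding dioph_sym_def using iff zero zero' by blast
qed

end
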